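(* There exists a constant $c>0$ such that for every integer $n\ge 2$ and every estimator $\hat f_n=\hat f_n(X_1,\ldots,X_n)$, $$\sup_{f\in\mathcal{F}}\ \mathbb{E}_{n,f}\int_{-\infty}^{\infty}\bigl(\hat f_n(x)-f(x)\bigr)^2\,dx\ \ge\ c\cdot \log n\cdot\frac{1}{n\sqrt{\log n}},$$ where, under $\mathbb{E}_{n,f}$, the observations $X_1,\ldots,X_n$ are independent and identically distributed with density $f\in\mathcal{F}$.
   Context: Let $\phi(x)=(2\pi)^{-1/2}e^{-x^2/2}$ be the standard normal density on $\mathbb{R}$, and let $\mathcal{P}(\mathbb{R})$ be the set of all Borel probability measures on $\mathbb{R}$. The class of normal location mixture densities is $$\mathcal{F}=\Bigl\{f:\ f(x)=(\phi\star\Pi)(x)=\int\phi(x-u)\,d\Pi(u),\ \Pi\in\mathcal{P}(\mathbb{R})\Bigr\}.$$ Densities are with respect to Lebesgue measure. $\mathbb{E}_{n,f}$ denotes expectation when $X_1,\ldots,X_n$ are i.i.d. with density $f$. An estimator $\hat f_n$ is a real-valued function $\hat f_n(x)=\hat f_n(x;X_1,\ldots,X_n)$ that is jointly measurable in $x$ and the observations; it need not belong to $\mathcal{F}$. The risk may take the value $+\infty$. The constant $c$ does not depend on $n$ or on the estimator. *)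

theory Defs
  imports "HOL-Probability.Probability"
begin

definition borel_prob_measures :: "real measure set" where
  "borel_prob_measures = {P. prob_space P \<and> sets P = sets borel}"

definition normal_mixture :: "real measure \<Rightarrow> real \<Rightarrow> real" where
  "normal_mixture P x = (\<integral>u. std_normal_density (x - u) \<partial>P)"

definition normal_mixtures :: "(real \<Rightarrow> real) set" where
  "normal_mixtures = normal_mixture ` borel_prob_measures"

(* Joint law of n i.i.d. observations with Lebesgue density f; the sample
   (X_1, ..., X_n) is a function on the index set {1..n}. *)
definition iid_law :: "nat \<Rightarrow> (real \<Rightarrow> real) \<Rightarrow> (nat \<Rightarrow> real) measure" where
  "iid_law n f = (\<Pi>\<^sub>M i\<in>{1..n}. density lborel (\<lambda>x. ennreal (f x)))"

(* fhat x X is the value at x of the estimate computed from the sample X. *)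
definition estimator :: "nat \<Rightarrow> (real \<Rightarrow> (nat \<Rightarrow> real) \<Rightarrow> real) \<Rightarrow> bool" where
  "estimator n fhat \<longleftrightarrow>
     (\<lambda>(x, X). fhat x X) \<in> borel_measurable (borel \<Otimes>\<^sub>M (\<Pi>\<^sub>M i\<in>{1..n}. borel))"

(* Expected integrated squared error, as an extended nonnegative number:
   both integrals may be infinite. *)
definition L2_risk :: "nat \<Rightarrow> (real \<Rightarrow> (nat \<Rightarrow> real) \<Rightarrow> real) \<Rightarrow> (real \<Rightarrow> real) \<Rightarrow> ennreal" where
  "L2_risk n fhat f =
     (\<integral>\<^sup>+ X. (\<integral>\<^sup>+ x. ennreal ((fhat x X - f x)\<^sup>2) \<partial>lborel) \<partial>iid_law n f)"

end

theory Submission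
  imports Defs
begin

text \<open>
  Let f be the density of N(0, 2). Convolving the standard normal density with
  the density phi(u) (1 + sum_j b_j exp(j^2) sin(2 j u)) gives f(x) (1 + sum_j b_j sin(j x)), so
  smoothing damps the frequency j by exp(-j^2) only. With all b_j = d or -d,
  where d is of order n^(-1/2), positivity of the mixing density therefore allows of the order of
  sqrt(ln n) frequencies. On [-pi, pi] the perturbations are orthogonal up to the bounded factor f,
  and changing a single coefficient alters the n-fold product law by a bounded chi-square amount, so
  every coordinate costs of the order of d^2 and Assouad's method adds these costs up.
\<close>

text \<open>The damping factor is a conditional mean: if U is N(0, 1) and x is U plus independent
  N(0, 1) noise, then U given x is N(x/2, 1/2), and sin(2 j U) averages to exp(-j^2) sin(j x). Sines
  are used, not cosines, because they integrate to zero against a centred normal density, so no tilt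
  needs renormalising. Two demands compete: the rate wants many frequencies with coefficients of
  size n^(-1/2), while positivity of the mixing density bounds the sum of d exp(j^2). A cutoff m
  near sqrt(ln n) / 2 keeps the sum of exp(j^2) below a constant times sqrt n, so d can be a
  constant times n^(-1/2), and m d^2 has the order sqrt(ln n) / n, which is ln n / (n sqrt(ln n)).
  Two sign patterns differing at j are not compared with each other but with a common reference, the
  tilt whose j-th coefficient is 0. Its chi-square integral against either of them stays bounded for
  the n-fold products. Since estimators are arbitrary and risks may be infinite, the loss is only
  bounded below, through sine coefficients of the estimate that do not depend on the signs.\<close>

section \<open>Gaussian integrals of sines\<close>

lemma has_bochner_integral_std_normal_density_sin:
  "has_bochner_integral lborel (\<lambda>x. std_normal_density x * sin (a + b * x)) (exp (- b\<^sup>2 / 2) * sin a)"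
proof -
  \<comment> \<open>The claim is the imaginary part of \<open>iexp a\<close> times the
    characteristic function of the standard normal law at \<open>b\<close>.\<close>
  let ?f = "\<lambda>x. std_normal_density x *\<^sub>R (iexp a * iexp (b * x))"
  have int: "integrable lborel ?f"
    by (rule Bochner_Integration.integrable_bound[where f = std_normal_density])
       (auto simp: norm_mult simp del: of_real_mult)
  have "integral\<^sup>L lborel ?f = (\<integral>x. iexp a * iexp (b * x) \<partial>std_normal_distribution)"
    by (subst integral_density) auto
  also have "\<dots> = iexp a * char std_normal_distribution b"
    by (simp add: char_def del: of_real_mult)
  also have "\<dots> = iexp a * complex_of_real (exp (- b\<^sup>2 / 2))"
    by (simp only: char_std_normal_distribution)
  finally have "has_bochner_integral lborel ?f (iexp a * complex_of_real (exp (- b\<^sup>2 / 2)))"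
    using int by (simp add: has_bochner_integral_iff)
  then have "has_bochner_integral lborel (\<lambda>x. Im (?f x)) (Im (iexp a * complex_of_real (exp (- b\<^sup>2 / 2))))"
    by (rule has_bochner_integral_bounded_linear[OF bounded_linear_Im])
  moreover have im: "Im (?f x) = std_normal_density x * sin (a + b * x)" for x
    by (simp add: exp_add[symmetric] ring_distribs[symmetric] Im_exp flip: of_real_add of_real_mult)
  moreover have "Im (iexp a * complex_of_real (exp (- b\<^sup>2 / 2))) = exp (- b\<^sup>2 / 2) * sin a"
    by (simp add: Im_exp)
  ultimately show ?thesis by (simp only: im)
qed

lemma has_bochner_integral_normal_density_sin:
  assumes "\<sigma> > 0"
  shows "has_bochner_integral lborel (\<lambda>x. normal_density \<mu> \<sigma> x * sin (a + b * x))
           (exp (- (b * \<sigma>)\<^sup>2 / 2) * sin (a + b * \<mu>))"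
proof -
  have 1: "std_normal_density x * sin (a + b * \<mu> + b * \<sigma> * x)
      = \<sigma> * (normal_density \<mu> \<sigma> (\<mu> + \<sigma> * x) * sin (a + b * (\<mu> + \<sigma> * x)))" for x
    using assms by (simp add: normal_density_def real_sqrt_mult field_simps power_mult_distrib)
  from has_bochner_integral_std_normal_density_sin[of "a + b * \<mu>" "b * \<sigma>"]
  have "has_bochner_integral lborel (\<lambda>x. \<sigma> * (normal_density \<mu> \<sigma> (\<mu> + \<sigma> * x) * sin (a + b * (\<mu> + \<sigma> * x))))
      (exp (- (b * \<sigma>)\<^sup>2 / 2) * sin (a + b * \<mu>))"
    unfolding 1 .
  then have "has_bochner_integral lborel (\<lambda>x. (1/\<sigma>) * (\<sigma> * (normal_density \<mu> \<sigma> (\<mu> + \<sigma> * x) * sin (a + b * (\<mu> + \<sigma> * x)))))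
      ((1/\<sigma>) * (exp (- (b * \<sigma>)\<^sup>2 / 2) * sin (a + b * \<mu>)))"
    using has_bochner_integral_mult_right by blast
  then show ?thesis
    using assms by (subst lborel_has_bochner_integral_real_affine_iff[of \<sigma> _ _ \<mu>]) (auto simp: field_simps)
qed

text \<open>Bayes' formula for a standard normal \<open>u\<close> observed with standard normal
  noise: the marginal N(0, 2) of \<open>x\<close> times the conditional law N(x/2, 1/2) of
  \<open>u\<close>. The exponents agree by completing the square.\<close>

lemma normal_density_mult_convolution_kernel:
  "std_normal_density u * std_normal_density (x - u)
     = normal_density 0 (sqrt 2) x * normal_density (x / 2) (sqrt (1/2)) u"
proof -
  have "sqrt (2 * pi) * sqrt (2 * pi) = sqrt (2 * pi * 2) * sqrt (2 * pi * (1/2))"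
    unfolding real_sqrt_mult[symmetric] by simp
  moreover have "- u\<^sup>2 / 2 + - (x - u)\<^sup>2 / 2 = - x\<^sup>2 / 4 + - (u - x / 2)\<^sup>2"
    by (simp add: power2_eq_square field_simps)
  ultimately show ?thesis
    by (simp add: normal_density_def mult_exp_exp[symmetric] flip: real_sqrt_mult) (simp add: mult_exp_exp)
qed

section \<open>Bessel's inequality and the orthogonality of sines\<close>

text \<open>Bessel's inequality for the difference of \<open>g\<close> and the target. The
  coefficients of \<open>g\<close> do not involve \<open>\<beta>\<close>, so one set of statistics
  serves all targets at once. If some \<open>g * s j\<close> is not integrable, the default value 0
  of its integral does no harm, because the right-hand side is then infinite.\<close>

lemma bessel_lower_bound:
  fixes s :: "'i \<Rightarrow> 'a \<Rightarrow> real"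
  assumes I: "finite I" and c: "c > 0"
    and s: "\<And>j. j \<in> I \<Longrightarrow> s j \<in> borel_measurable M"
    and ortho_int: "\<And>j k. j \<in> I \<Longrightarrow> k \<in> I \<Longrightarrow> integrable M (\<lambda>x. s j x * s k x)"
    and ortho: "\<And>j k. j \<in> I \<Longrightarrow> k \<in> I \<Longrightarrow> (\<integral>x. s j x * s k x \<partial>M) = (if j = k then c else 0)"
    and g: "g \<in> borel_measurable M"
  shows "ennreal (c * (\<Sum>j\<in>I. ((\<integral>x. g x * s j x \<partial>M) / c - \<beta> j)\<^sup>2))
    \<le> (\<integral>\<^sup>+x. ennreal ((g x - (\<Sum>j\<in>I. \<beta> j * s j x))\<^sup>2) \<partial>M)"
proof (cases "(\<integral>\<^sup>+x. ennreal ((g x - (\<Sum>j\<in>I. \<beta> j * s j x))\<^sup>2) \<partial>M) = \<infinity>")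
  case False
  \<comment> \<open>In the finite case \<open>h\<close> is square integrable, so every product
    \<open>h * s j\<close> is integrable by AM-GM.\<close>
  define h where "h x = g x - (\<Sum>j\<in>I. \<beta> j * s j x)" for x
  have h[measurable]: "h \<in> borel_measurable M"
    unfolding h_def using g s by measurable
  have h2: "integrable M (\<lambda>x. (h x)\<^sup>2)"
    using False by (intro integrableI_nonneg) (auto simp: h_def[symmetric] less_top)
  have hs: "integrable M (\<lambda>x. h x * s j x)" if "j \<in> I" for j
  proof (rule Bochner_Integration.integrable_bound)
    show "integrable M (\<lambda>x. (h x)\<^sup>2 + s j x * s j x)"
      using h2 ortho_int[OF that that] by simp
    show "(\<lambda>x. h x * s j x) \<in> borel_measurable M" using s[OF that] by measurable
    have "\<bar>h x * s j x\<bar> \<le> (h x)\<^sup>2 + s j x * s j x" for x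
    proof -
      have "2 * (\<bar>h x\<bar> * \<bar>s j x\<bar>) \<le> (h x)\<^sup>2 + (s j x)\<^sup>2"
        using sum_squares_bound[of "\<bar>h x\<bar>" "\<bar>s j x\<bar>"] by (simp add: mult.assoc)
      moreover have "0 \<le> \<bar>h x\<bar> * \<bar>s j x\<bar>" by simp
      ultimately show ?thesis unfolding abs_mult power2_eq_square[of "s j x", symmetric] by linarith
    qed
    then show "AE x in M. norm (h x * s j x) \<le> norm ((h x)\<^sup>2 + s j x * s j x)"
      by (auto intro: order_trans[OF _ abs_ge_self])
  qed
  define d where "d j = (\<integral>x. g x * s j x \<partial>M) / c - \<beta> j" for j
  have hd: "(\<integral>x. h x * s j x \<partial>M) = c * d j" if "j \<in> I" for j
  proof -
    have "g x * s j x = h x * s j x + (\<Sum>k\<in>I. \<beta> k * (s k x * s j x))" for x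
      by (simp add: h_def algebra_simps sum_distrib_left)
    then have "(\<integral>x. g x * s j x \<partial>M) = (\<integral>x. h x * s j x + (\<Sum>k\<in>I. \<beta> k * (s k x * s j x)) \<partial>M)" by simp
    also have "\<dots> = (\<integral>x. h x * s j x \<partial>M) + (\<Sum>k\<in>I. \<beta> k * (\<integral>x. s k x * s j x \<partial>M))"
      using ortho_int that hs by simp
    also have "(\<Sum>k\<in>I. \<beta> k * (\<integral>x. s k x * s j x \<partial>M)) = (\<Sum>k\<in>I. if j = k then c * \<beta> k else 0)"
      by (intro sum.cong) (auto simp: ortho that)
    finally show ?thesis
      using c I that by (simp add: d_def field_simps)
  qed
  \<comment> \<open>\<open>d j\<close> is the coefficient of \<open>h\<close> along
    \<open>s j\<close>. The squared norm of \<open>h\<close> minus its projection is expanded here;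
    its nonnegativity gives the bound.\<close>
  have e: "(h x - (\<Sum>j\<in>I. d j * s j x))\<^sup>2
      = (h x)\<^sup>2 - 2 * (\<Sum>j\<in>I. d j * (h x * s j x)) + (\<Sum>j\<in>I. \<Sum>k\<in>I. d j * d k * (s j x * s k x))" for x
    by (simp add: power2_diff power2_eq_square[of "sum _ _"] sum_product sum_distrib_left mult_ac)
  have "0 \<le> (\<integral>x. (h x - (\<Sum>j\<in>I. d j * s j x))\<^sup>2 \<partial>M)"
    by simp
  also have "\<dots> = (\<integral>x. (h x)\<^sup>2 \<partial>M) - 2 * (\<Sum>j\<in>I. d j * (c * d j))
      + (\<Sum>j\<in>I. \<Sum>k\<in>I. d j * d k * (if j = k then c else 0))"
    unfolding e using h2 hs ortho_int by (simp add: hd ortho cong: sum.cong)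
  also have "\<dots> = (\<integral>x. (h x)\<^sup>2 \<partial>M) - c * (\<Sum>j\<in>I. (d j)\<^sup>2)"
    using I by (simp add: if_distrib sum_distrib_left power2_eq_square algebra_simps cong: if_cong)
  finally have "ennreal (c * (\<Sum>j\<in>I. (d j)\<^sup>2)) \<le> ennreal (\<integral>x. (h x)\<^sup>2 \<partial>M)"
    by (intro ennreal_leI) simp
  also have "\<dots> = (\<integral>\<^sup>+x. ennreal ((h x)\<^sup>2) \<partial>M)"
    using h2 by (simp add: nn_integral_eq_integral)
  finally show ?thesis by (simp add: h_def d_def)
qed simp

lemma integral_cos_mult_zero:
  fixes a :: real
  assumes "a \<noteq> 0" "sin (a * pi) = 0"
  shows "(\<integral>x. indicator {-pi..pi} x *\<^sub>R cos (a * x) \<partial>lborel) = 0"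
proof -
  have "(\<integral>x. indicator {-pi..pi} x *\<^sub>R cos (a * x) \<partial>lborel) = sin (a * pi) / a - sin (a * (-pi)) / a"
    using assms by (intro integral_FTC_Icc) (auto intro!: derivative_eq_intros continuous_intros simp flip: has_real_derivative_iff_has_vector_derivative)
  with assms show ?thesis by simp
qed

text \<open>Product-to-sum formulas: for positive indices the frequency j + k never vanishes, and j
  - k vanishes only on the diagonal.\<close>

lemma
  fixes j k :: nat
  assumes "j > 0" "k > 0"
  shows integrable_sin_mult_sin:
      "integrable (restrict_space lborel {-pi..pi}) (\<lambda>x. sin (j * x) * sin (k * x))" (is ?I)
    and integral_sin_mult_sin:
      "(\<integral>x. sin (j * x) * sin (k * x) \<partial>restrict_space lborel {-pi..pi}) = (if j = k then pi else 0)" (is ?E)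
proof -
  have cont: "continuous_on {-pi..pi} (\<lambda>x. sin (real j * x) * sin (real k * x))"
    by (intro continuous_intros)
  show ?I
    using borel_integrable_atLeastAtMost'[of "-pi" pi "\<lambda>x. sin (real j * x) * sin (real k * x)", OF cont]
    by (subst integrable_restrict_space) (auto simp: set_integrable_def)
  have c: "integrable lborel (\<lambda>x. indicator {-pi..pi} x *\<^sub>R cos (a * x))" for a :: real
    using borel_integrable_atLeastAtMost'[of "-pi" pi "\<lambda>x. cos (a * x)"]
    by (simp add: set_integrable_def continuous_on_cos continuous_on_mult_left)
  have p: "(\<integral>x. indicator {-pi..pi} x *\<^sub>R cos ((real j + real k) * x) \<partial>lborel) = 0"
    using assms sin_npi[of "j + k"] by (intro integral_cos_mult_zero) auto
  have m: "(\<integral>x. indicator {-pi..pi} x *\<^sub>R cos ((real j - real k) * x) \<partial>lborel) = (if j = k then 2 * pi else 0)"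
  proof (cases "j = k")
    case False
    have "sin ((real j - real k) * pi) = 0"
      by (simp add: left_diff_distrib sin_diff)
    with False show ?thesis by (subst integral_cos_mult_zero) auto
  qed simp
  have "(\<integral>x. sin (j * x) * sin (k * x) \<partial>restrict_space lborel {-pi..pi})
    = (\<integral>x. (1/2) * (indicator {-pi..pi} x *\<^sub>R cos ((real j - real k) * x)) - (1/2) * (indicator {-pi..pi} x *\<^sub>R cos ((real j + real k) * x)) \<partial>lborel)"
    by (subst integral_restrict_space) (auto intro!: Bochner_Integration.integral_cong simp: cos_diff cos_add algebra_simps)
  also have "\<dots> = (1/2) * (\<integral>x. indicator {-pi..pi} x *\<^sub>R cos ((real j - real k) * x) \<partial>lborel)
      - (1/2) * (\<integral>x. indicator {-pi..pi} x *\<^sub>R cos ((real j + real k) * x) \<partial>lborel)"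
    using c by (subst Bochner_Integration.integral_diff) auto
  finally show ?E unfolding m p by (cases "j = k") auto
qed

section \<open>Assouad's method with chi-square integrals\<close>

text \<open>The two squared errors are linearised in \<open>r\<close> by AM-GM; \<open>l\<close> is optimised later. No
  measurability of \<open>t\<close> is needed this way, since it is eliminated pointwise.\<close>

lemma two_point_bound:
  fixes p q r t d l :: real
  assumes "p > 0" "q > 0" "r \<ge> 0" "d \<ge> 0" "l \<ge> 0"
  shows "4 * l * d\<^sup>2 * r \<le> (t + d)\<^sup>2 * p + (t - d)\<^sup>2 * q + l\<^sup>2 * d\<^sup>2 * (r\<^sup>2 / p + r\<^sup>2 / q)"
proof -
  have *: "2 * (l * d * r) * u \<le> u\<^sup>2 * p + l\<^sup>2 * d\<^sup>2 * (r\<^sup>2 / p)" if "p > 0" for u p :: real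
  proof -
    have "0 \<le> (u * p - l * d * r)\<^sup>2 / p" using that by simp
    also have "\<dots> = u\<^sup>2 * p + l\<^sup>2 * d\<^sup>2 * (r\<^sup>2 / p) - 2 * (l * d * r) * u"
      using that by (simp add: power2_eq_square field_simps)
    finally show ?thesis by simp
  qed
  \<comment> \<open>The points \<open>t + d\<close> and \<open>d - t\<close> are chosen so that
    \<open>t\<close> cancels from the sum of the linear terms.\<close>
  have "2 * (l * d * r) * (t + d) + 2 * (l * d * r) * (d - t)
     \<le> (t + d)\<^sup>2 * p + l\<^sup>2 * d\<^sup>2 * (r\<^sup>2 / p) + ((d - t)\<^sup>2 * q + l\<^sup>2 * d\<^sup>2 * (r\<^sup>2 / q))"
    by (intro add_mono * assms)
  then show ?thesis by (simp add: power2_eq_square algebra_simps)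
qed

text \<open>With subsets read as vertices of a cube, this groups the vertices into the edges in
  direction \<open>j\<close>.\<close>

lemma sum_Pow_remove:
  fixes F :: "'i set \<Rightarrow> 'a :: comm_monoid_add"
  assumes "finite I" "j \<in> I"
  shows "(\<Sum>S\<in>Pow I. F S) = (\<Sum>S\<in>Pow (I - {j}). F S + F (insert j S))"
proof -
  have I: "I = insert j (I - {j})" using assms by auto
  have "(\<Sum>S\<in>Pow I. F S) = (\<Sum>S\<in>Pow (I - {j}) \<union> insert j ` Pow (I - {j}). F S)"
    by (subst I, subst Pow_insert) (rule refl)
  also have "\<dots> = (\<Sum>S\<in>Pow (I - {j}). F S) + (\<Sum>S\<in>insert j ` Pow (I - {j}). F S)"
    using assms by (intro sum.union_disjoint) auto
  also have "(\<Sum>S\<in>insert j ` Pow (I - {j}). F S) = (\<Sum>S\<in>Pow (I - {j}). F (insert j S))"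
    by (subst sum.reindex) (auto intro!: inj_onI)
  finally show ?thesis by (simp add: sum.distrib)
qed

text \<open>Sign vectors are encoded as subsets: \<open>Pow I\<close> is then the cube of all
  patterns, and turning a sign from -1 to 1 is an \<open>insert\<close>.\<close>

definition sgn_mem :: "'i set \<Rightarrow> 'i \<Rightarrow> real" where
  "sgn_mem S j = (if j \<in> S then 1 else -1)"

lemma sum_sum_ennreal_cmult:
  assumes "c \<ge> 0" "\<And>j S. j \<in> I \<Longrightarrow> S \<in> A j \<Longrightarrow> f j S \<ge> 0"
  shows "(\<Sum>j\<in>I. \<Sum>S\<in>A j. ennreal c * ennreal (f j S)) = ennreal (\<Sum>j\<in>I. \<Sum>S\<in>A j. c * f j S)"
proof -
  have "(\<Sum>S\<in>A j. ennreal c * ennreal (f j S)) = ennreal (\<Sum>S\<in>A j. c * f j S)" if "j \<in> I" for j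
    using assms that by (subst sum_ennreal[symmetric]) (auto intro!: sum.cong simp: ennreal_mult)
  then show ?thesis
    using assms by (subst sum_ennreal[symmetric]) (auto intro!: sum_nonneg)
qed

lemma nn_integral_sum_sum_cmult:
  fixes f :: "'i \<Rightarrow> 'j \<Rightarrow> 'a \<Rightarrow> ennreal"
  assumes f: "\<And>j S. j \<in> I \<Longrightarrow> S \<in> A j \<Longrightarrow> f j S \<in> borel_measurable M"
  shows "(\<integral>\<^sup>+x. (\<Sum>j\<in>I. \<Sum>S\<in>A j. c * f j S x) \<partial>M) = (\<Sum>j\<in>I. \<Sum>S\<in>A j. c * (\<integral>\<^sup>+x. f j S x \<partial>M))"
proof -
  have m: "(\<lambda>x. c * f j S x) \<in> borel_measurable M" if "j \<in> I" "S \<in> A j" for j S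
    using f[OF that] by measurable
  have "(\<integral>\<^sup>+x. (\<Sum>S\<in>A j. c * f j S x) \<partial>M) = (\<Sum>S\<in>A j. c * (\<integral>\<^sup>+x. f j S x \<partial>M))" if j: "j \<in> I" for j
    using m[OF j] f[OF j] by (subst nn_integral_sum) (auto intro!: sum.cong nn_integral_cmult)
  then show ?thesis
    using m by (subst nn_integral_sum) (auto intro!: borel_measurable_sum)
qed

text \<open>By \<open>r_insert\<close> both ends of an edge in direction \<open>j\<close> share the
  reference density \<open>r j S\<close>. Integrating \<open>two_point_bound\<close> along an edge
  gives at least 4 l d^2 - 2 l^2 d^2 C, and these gains are summed over all edges.\<close>

lemma assouad_chi_square:
  fixes p :: "'i set \<Rightarrow> 'a \<Rightarrow> real" and r :: "'i \<Rightarrow> 'i set \<Rightarrow> 'a \<Rightarrow> real"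
    and t :: "'i \<Rightarrow> 'a \<Rightarrow> real" and L :: "'i set \<Rightarrow> 'a \<Rightarrow> ennreal"
  assumes I: "finite I" and d: "d \<ge> 0" and C: "C > 0"
    and p[measurable]: "\<And>S. S \<subseteq> I \<Longrightarrow> p S \<in> borel_measurable M"
    and p_pos: "\<And>S x. S \<subseteq> I \<Longrightarrow> x \<in> space M \<Longrightarrow> p S x > 0"
    and r[measurable]: "\<And>j S. j \<in> I \<Longrightarrow> S \<subseteq> I \<Longrightarrow> r j S \<in> borel_measurable M"
    and r_nonneg: "\<And>j S x. j \<in> I \<Longrightarrow> S \<subseteq> I \<Longrightarrow> x \<in> space M \<Longrightarrow> r j S x \<ge> 0"
    and r_insert: "\<And>j S. r j (insert j S) = r j S"
    and r_int: "\<And>j S. j \<in> I \<Longrightarrow> S \<subseteq> I \<Longrightarrow> (\<integral>\<^sup>+x. ennreal (r j S x) \<partial>M) = 1"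
    and chi: "\<And>j S. j \<in> I \<Longrightarrow> S \<subseteq> I \<Longrightarrow> (\<integral>\<^sup>+x. ennreal ((r j S x)\<^sup>2 / p S x) \<partial>M) \<le> ennreal C"
    and L[measurable]: "\<And>S. S \<subseteq> I \<Longrightarrow> L S \<in> borel_measurable M"
    and L_ge: "\<And>S x. S \<subseteq> I \<Longrightarrow> x \<in> space M \<Longrightarrow>
        ennreal (\<Sum>j\<in>I. (t j x - d * sgn_mem S j)\<^sup>2) \<le> L S x"
  shows "ennreal (real (card I) * 2 ^ card I * d\<^sup>2 / C)
    \<le> (\<Sum>S\<in>Pow I. \<integral>\<^sup>+x. ennreal (p S x) * L S x \<partial>M)"
proof -
  \<comment> \<open>This value maximises 4 l - 2 C l^2, leaving 2 d^2 / C per edge.\<close>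
  define l where "l = 1 / C"
  have l: "l > 0" using C by (simp add: l_def)
  let ?P = "\<lambda>j. Pow (I - {j})"
  have pw: "(\<Sum>j\<in>I. \<Sum>S\<in>?P j. 4 * l * d\<^sup>2 * r j S x) \<le>
      (\<Sum>S\<in>Pow I. (\<Sum>j\<in>I. (t j x - d * sgn_mem S j)\<^sup>2) * p S x)
      + (\<Sum>j\<in>I. \<Sum>S\<in>Pow I. l\<^sup>2 * d\<^sup>2 * ((r j S x)\<^sup>2 / p S x))" if x: "x \<in> space M" for x
  proof -
    have "(\<Sum>S\<in>?P j. 4 * l * d\<^sup>2 * r j S x) \<le>
       (\<Sum>S\<in>Pow I. (t j x - d * sgn_mem S j)\<^sup>2 * p S x + l\<^sup>2 * d\<^sup>2 * ((r j S x)\<^sup>2 / p S x))" if j: "j \<in> I" for j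
      unfolding sum_Pow_remove[OF I j]
    proof (rule sum_mono)
      fix S assume S: "S \<in> ?P j"
      then have S': "S \<subseteq> I" "insert j S \<subseteq> I" "j \<notin> S" using j by auto
      show "4 * l * d\<^sup>2 * r j S x \<le> (t j x - d * sgn_mem S j)\<^sup>2 * p S x + l\<^sup>2 * d\<^sup>2 * ((r j S x)\<^sup>2 / p S x) +
          ((t j x - d * sgn_mem (insert j S) j)\<^sup>2 * p (insert j S) x + l\<^sup>2 * d\<^sup>2 * ((r j (insert j S) x)\<^sup>2 / p (insert j S) x))"
        using two_point_bound[OF p_pos[OF S'(1) x] p_pos[OF S'(2) x] r_nonneg[OF j S'(1) x] d, of l "t j x"] l S'(3)
        by (simp add: sgn_mem_def r_insert ring_distribs)
    qed
    then have "(\<Sum>j\<in>I. \<Sum>S\<in>?P j. 4 * l * d\<^sup>2 * r j S x) \<le> (\<Sum>j\<in>I.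
       (\<Sum>S\<in>Pow I. (t j x - d * sgn_mem S j)\<^sup>2 * p S x + l\<^sup>2 * d\<^sup>2 * ((r j S x)\<^sup>2 / p S x)))"
      by (rule sum_mono)
    also have "\<dots> = (\<Sum>S\<in>Pow I. (\<Sum>j\<in>I. (t j x - d * sgn_mem S j)\<^sup>2) * p S x)
      + (\<Sum>j\<in>I. \<Sum>S\<in>Pow I. l\<^sup>2 * d\<^sup>2 * ((r j S x)\<^sup>2 / p S x))"
      by (simp add: sum.distrib sum_distrib_right) (rule sum.swap)
    finally show ?thesis .
  qed
  \<comment> \<open>The pointwise inequality moves to \<open>ennreal\<close> before integration,
    since the loss \<open>L S\<close> may be infinite.\<close>
  have pwe: "(\<Sum>j\<in>I. \<Sum>S\<in>?P j. ennreal (4 * l * d\<^sup>2) * ennreal (r j S x)) \<le>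
      (\<Sum>S\<in>Pow I. ennreal (p S x) * L S x)
      + (\<Sum>j\<in>I. \<Sum>S\<in>Pow I. ennreal (l\<^sup>2 * d\<^sup>2) * ennreal ((r j S x)\<^sup>2 / p S x))" if x: "x \<in> space M" for x
  proof -
    have sub: "S \<subseteq> I" if "S \<in> ?P j" for S j using that by auto
    have "(\<Sum>j\<in>I. \<Sum>S\<in>?P j. ennreal (4 * l * d\<^sup>2) * ennreal (r j S x))
       = ennreal (\<Sum>j\<in>I. \<Sum>S\<in>?P j. 4 * l * d\<^sup>2 * r j S x)"
      using l d x r_nonneg sub by (intro sum_sum_ennreal_cmult) auto
    also have "\<dots> \<le> ennreal ((\<Sum>S\<in>Pow I. (\<Sum>j\<in>I. (t j x - d * sgn_mem S j)\<^sup>2) * p S x)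
      + (\<Sum>j\<in>I. \<Sum>S\<in>Pow I. l\<^sup>2 * d\<^sup>2 * ((r j S x)\<^sup>2 / p S x)))"
      using pw[OF x] by (rule ennreal_leI)
    also have "\<dots> = ennreal (\<Sum>S\<in>Pow I. (\<Sum>j\<in>I. (t j x - d * sgn_mem S j)\<^sup>2) * p S x)
      + ennreal (\<Sum>j\<in>I. \<Sum>S\<in>Pow I. l\<^sup>2 * d\<^sup>2 * ((r j S x)\<^sup>2 / p S x))"
      using p_pos x by (intro ennreal_plus sum_nonneg mult_nonneg_nonneg) (auto simp: less_imp_le)
    also have "ennreal (\<Sum>S\<in>Pow I. (\<Sum>j\<in>I. (t j x - d * sgn_mem S j)\<^sup>2) * p S x)
        = (\<Sum>S\<in>Pow I. ennreal (p S x) * ennreal (\<Sum>j\<in>I. (t j x - d * sgn_mem S j)\<^sup>2))"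
    proof (subst sum_ennreal[symmetric])
      fix S assume S: "S \<in> Pow I"
      show "0 \<le> (\<Sum>j\<in>I. (t j x - d * sgn_mem S j)\<^sup>2) * p S x"
        using S p_pos[OF _ x, of S] by (intro mult_nonneg_nonneg sum_nonneg) auto
    next
      show "(\<Sum>S\<in>Pow I. ennreal ((\<Sum>j\<in>I. (t j x - d * sgn_mem S j)\<^sup>2) * p S x))
          = (\<Sum>S\<in>Pow I. ennreal (p S x) * ennreal (\<Sum>j\<in>I. (t j x - d * sgn_mem S j)\<^sup>2))"
        using p_pos[OF _ x]
        by (intro sum.cong refl, subst ennreal_mult[symmetric]) (auto simp: mult.commute less_imp_le intro!: sum_nonneg)
    qed
    also have "\<dots> \<le> (\<Sum>S\<in>Pow I. ennreal (p S x) * L S x)"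
      using L_ge x by (intro sum_mono mult_left_mono) auto
    also have "ennreal (\<Sum>j\<in>I. \<Sum>S\<in>Pow I. l\<^sup>2 * d\<^sup>2 * ((r j S x)\<^sup>2 / p S x))
        = (\<Sum>j\<in>I. \<Sum>S\<in>Pow I. ennreal (l\<^sup>2 * d\<^sup>2) * ennreal ((r j S x)\<^sup>2 / p S x))"
      using p_pos x by (intro sum_sum_ennreal_cmult[symmetric]) (auto simp: less_imp_le)
    finally show ?thesis by (simp add: add_right_mono)
  qed
  \<comment> \<open>Twice the number of edges: each of the \<open>card I\<close> directions has half
    as many edges as the cube has vertices.\<close>
  let ?K = "real (card I) * 2 ^ card I"
  have sub: "S \<subseteq> I" if "S \<in> ?P j" for S j using that by auto
  have rm: "r j S \<in> borel_measurable M" if "j \<in> I" "S \<subseteq> I - {j}" for j S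
    using that by (intro r) auto
  have cardP: "(\<Sum>j\<in>I. real (card (?P j))) = ?K / 2"
    using I by (simp add: card_Pow card_Diff_singleton) (cases "card I"; simp)
  have "ennreal (?K / 2 * (4 * l * d\<^sup>2)) = ennreal (\<Sum>j\<in>I. \<Sum>S\<in>?P j. 4 * l * d\<^sup>2 * 1)"
    unfolding cardP[symmetric] by (simp add: sum_distrib_right del: card_Pow)
  also have "\<dots> = (\<Sum>j\<in>I. \<Sum>S\<in>?P j. ennreal (4 * l * d\<^sup>2) * ennreal 1)"
    using l by (intro sum_sum_ennreal_cmult[symmetric]) auto
  also have "\<dots> = (\<Sum>j\<in>I. \<Sum>S\<in>?P j. ennreal (4 * l * d\<^sup>2) * (\<integral>\<^sup>+x. ennreal (r j S x) \<partial>M))"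
    using r_int sub by (intro sum.cong refl) auto
  also have "\<dots> = (\<integral>\<^sup>+x. (\<Sum>j\<in>I. \<Sum>S\<in>?P j. ennreal (4 * l * d\<^sup>2) * ennreal (r j S x)) \<partial>M)"
    using rm by (intro nn_integral_sum_sum_cmult[symmetric]) auto
  also have "\<dots> \<le> (\<integral>\<^sup>+x. (\<Sum>S\<in>Pow I. ennreal (p S x) * L S x)
      + (\<Sum>j\<in>I. \<Sum>S\<in>Pow I. ennreal (l\<^sup>2 * d\<^sup>2) * ennreal ((r j S x)\<^sup>2 / p S x)) \<partial>M)"
    by (intro nn_integral_mono pwe)
  also have "\<dots> = (\<Sum>S\<in>Pow I. \<integral>\<^sup>+x. ennreal (p S x) * L S x \<partial>M)
      + (\<Sum>j\<in>I. \<Sum>S\<in>Pow I. ennreal (l\<^sup>2 * d\<^sup>2) * (\<integral>\<^sup>+x. ennreal ((r j S x)\<^sup>2 / p S x) \<partial>M))"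
  proof (subst nn_integral_add)
    show "(\<integral>\<^sup>+x. (\<Sum>S\<in>Pow I. ennreal (p S x) * L S x) \<partial>M)
        + (\<integral>\<^sup>+x. (\<Sum>j\<in>I. \<Sum>S\<in>Pow I. ennreal (l\<^sup>2 * d\<^sup>2) * ennreal ((r j S x)\<^sup>2 / p S x)) \<partial>M)
      = (\<Sum>S\<in>Pow I. \<integral>\<^sup>+x. ennreal (p S x) * L S x \<partial>M)
        + (\<Sum>j\<in>I. \<Sum>S\<in>Pow I. ennreal (l\<^sup>2 * d\<^sup>2) * (\<integral>\<^sup>+x. ennreal ((r j S x)\<^sup>2 / p S x) \<partial>M))"
      by (intro arg_cong2[of _ _ _ _ "(+)"] nn_integral_sum nn_integral_sum_sum_cmult) auto
  qed (auto intro!: borel_measurable_sum)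
  also have "\<dots> \<le> (\<Sum>S\<in>Pow I. \<integral>\<^sup>+x. ennreal (p S x) * L S x \<partial>M)
      + (\<Sum>j\<in>I. \<Sum>S\<in>Pow I. ennreal (l\<^sup>2 * d\<^sup>2) * ennreal C)"
    by (intro add_left_mono sum_mono mult_left_mono chi) auto
  also have "(\<Sum>j\<in>I. \<Sum>S\<in>Pow I. ennreal (l\<^sup>2 * d\<^sup>2) * ennreal C) = ennreal (?K * (l\<^sup>2 * d\<^sup>2 * C))"
    using I C by (simp add: card_Pow ennreal_mult ennreal_of_nat_eq_real_of_nat ennreal_power[symmetric] mult.assoc)
  \<comment> \<open>The chi-square contribution is finite, so it can be moved to the left by
    subtraction.\<close>
  finally have "ennreal (?K / 2 * (4 * l * d\<^sup>2)) - ennreal (?K * (l\<^sup>2 * d\<^sup>2 * C))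
      \<le> (\<Sum>S\<in>Pow I. \<integral>\<^sup>+x. ennreal (p S x) * L S x \<partial>M)"
    by (simp add: ennreal_minus_le_iff add.commute)
  moreover have "ennreal (?K / 2 * (4 * l * d\<^sup>2)) - ennreal (?K * (l\<^sup>2 * d\<^sup>2 * C)) = ennreal (?K * d\<^sup>2 / C)"
    using C d by (subst ennreal_minus) (auto simp: l_def power2_eq_square field_simps)
  ultimately show ?thesis by simp
qed

section \<open>Product densities\<close>

text \<open>Puts the laws of the samples on one dominating measure, as the Assouad bound requires.
  Boxes determine a product measure, and on boxes both sides factor.\<close>

lemma PiM_density_lborel:
  fixes f :: "real \<Rightarrow> real"
  assumes I: "finite I" and [measurable]: "f \<in> borel_measurable borel" and nn: "\<And>x. f x \<ge> 0"
    and sf: "sigma_finite_measure (density lborel (\<lambda>x. ennreal (f x)))"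
  shows "(\<Pi>\<^sub>M i\<in>I. density lborel (\<lambda>x. ennreal (f x)))
     = density (\<Pi>\<^sub>M i\<in>I. lborel) (\<lambda>X. ennreal (\<Prod>i\<in>I. f (X i)))"
proof -
  interpret D: product_sigma_finite "\<lambda>_. density lborel (\<lambda>x. ennreal (f x))"
    by (rule product_sigma_finite.intro) (rule sf)
  interpret B: product_sigma_finite "\<lambda>_. lborel :: real measure"
    by (rule product_sigma_finite.intro) (rule sigma_finite_lborel)
  show ?thesis
  proof (rule D.PiM_eqI[OF I, symmetric])
    show "sets (density (Pi\<^sub>M I (\<lambda>i. lborel)) (\<lambda>X. ennreal (\<Prod>i\<in>I. f (X i))))
       = sets (\<Pi>\<^sub>M i\<in>I. density lborel (\<lambda>x. ennreal (f x)))"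
      by (simp cong: sets_PiM_cong)
    fix A :: "_ \<Rightarrow> real set" assume A: "\<And>i. i \<in> I \<Longrightarrow> A i \<in> sets (density lborel (\<lambda>x. ennreal (f x)))"
    then have A'[measurable]: "\<And>i. i \<in> I \<Longrightarrow> A i \<in> sets borel" by simp
    have "emeasure (density (Pi\<^sub>M I (\<lambda>i. lborel)) (\<lambda>X. ennreal (\<Prod>i\<in>I. f (X i)))) (Pi\<^sub>E I A)
      = (\<integral>\<^sup>+X. ennreal (\<Prod>i\<in>I. f (X i)) * indicator (Pi\<^sub>E I A) X \<partial>Pi\<^sub>M I (\<lambda>i. lborel))"
      using I by (subst emeasure_density) (auto intro!: sets_PiM_I_finite)
    also have "\<dots> = (\<integral>\<^sup>+X. (\<Prod>i\<in>I. ennreal (f (X i)) * indicator (A i) (X i)) \<partial>Pi\<^sub>M I (\<lambda>i. lborel))"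
    proof (rule nn_integral_cong)
      fix X :: "_ \<Rightarrow> real" assume "X \<in> space (Pi\<^sub>M I (\<lambda>i. lborel))"
      then have "indicator (Pi\<^sub>E I A) X = (\<Prod>i\<in>I. indicator (A i) (X i) :: ennreal)"
        using I by (auto simp: indicator_def space_PiM PiE_iff prod_zero_iff)
      then show "ennreal (\<Prod>i\<in>I. f (X i)) * indicator (Pi\<^sub>E I A) X = (\<Prod>i\<in>I. ennreal (f (X i)) * indicator (A i) (X i))"
        using nn by (simp add: prod.distrib prod_ennreal)
    qed
    also have "\<dots> = (\<Prod>i\<in>I. \<integral>\<^sup>+x. ennreal (f x) * indicator (A i) x \<partial>lborel)"
      using I by (intro B.product_nn_integral_prod) auto
    also have "\<dots> = (\<Prod>i\<in>I. emeasure (density lborel (\<lambda>x. ennreal (f x))) (A i))"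
      by (intro prod.cong refl emeasure_density[symmetric]) auto
    finally show "emeasure (density (Pi\<^sub>M I (\<lambda>i. lborel)) (\<lambda>X. ennreal (\<Prod>i\<in>I. f (X i)))) (Pi\<^sub>E I A)
      = (\<Prod>i\<in>I. emeasure (density lborel (\<lambda>x. ennreal (f x))) (A i))" .
  qed
qed

text \<open>Used twice: for the total mass of product densities and to reduce the n-fold chi-square
  integral to a power of the one-dimensional one.\<close>

lemma nn_integral_PiM_lborel_prod:
  fixes f :: "real \<Rightarrow> real"
  assumes I: "finite I" and [measurable]: "f \<in> borel_measurable borel" and nn: "\<And>x. f x \<ge> 0"
  shows "(\<integral>\<^sup>+X. ennreal (\<Prod>i\<in>I. f (X i)) \<partial>Pi\<^sub>M I (\<lambda>i. lborel)) = (\<integral>\<^sup>+x. ennreal (f x) \<partial>lborel) ^ card I"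
proof -
  interpret B: product_sigma_finite "\<lambda>_. lborel :: real measure"
    by (rule product_sigma_finite.intro) (rule sigma_finite_lborel)
  show ?thesis
    using B.product_nn_integral_prod[OF I, of "\<lambda>_ x. ennreal (f x)"] nn by (simp add: prod_ennreal[symmetric])
qed

section \<open>The normal density tilted by sine polynomials\<close>

definition sine_poly :: "nat \<Rightarrow> (nat \<Rightarrow> real) \<Rightarrow> real \<Rightarrow> real" where
  "sine_poly m \<beta> x = (\<Sum>j\<in>{1..m}. \<beta> j * sin (real j * x))"

text \<open>\<open>\<beta>\<close> lists the coefficients after smoothing; the mixing density
  carries \<open>\<beta> j * exp ((real j)\<^sup>2)\<close> at the doubled frequency.\<close>

definition sine_tilt :: "nat \<Rightarrow> (nat \<Rightarrow> real) \<Rightarrow> real \<Rightarrow> real" where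
  "sine_tilt m \<beta> x = normal_density 0 (sqrt 2) x * (1 + sine_poly m \<beta> x)"

lemma sine_poly_measurable [measurable]: "sine_poly m \<beta> \<in> borel_measurable borel"
  unfolding sine_poly_def by measurable

lemma sine_tilt_measurable [measurable]: "sine_tilt m \<beta> \<in> borel_measurable borel"
  unfolding sine_tilt_def by measurable

lemma abs_sum_mult_sin_le:
  fixes c \<theta> :: "nat \<Rightarrow> real"
  shows "\<bar>\<Sum>j\<in>A. c j * sin (\<theta> j)\<bar> \<le> (\<Sum>j\<in>A. \<bar>c j\<bar>)"
proof -
  have "\<bar>\<Sum>j\<in>A. c j * sin (\<theta> j)\<bar> \<le> (\<Sum>j\<in>A. \<bar>c j * sin (\<theta> j)\<bar>)"
    by (rule sum_abs)
  also have "\<dots> \<le> (\<Sum>j\<in>A. \<bar>c j\<bar>)"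
    by (intro sum_mono) (simp add: abs_mult mult_left_le)
  finally show ?thesis .
qed

lemma abs_sine_poly_le: "\<bar>sine_poly m \<beta> x\<bar> \<le> (\<Sum>j\<in>{1..m}. \<bar>\<beta> j\<bar>)"
  unfolding sine_poly_def by (rule abs_sum_mult_sin_le)

text \<open>Each sine is odd and the density even, so the perturbation has integral zero whatever
  its coefficients are.\<close>

lemma has_bochner_integral_sine_tilt: "has_bochner_integral lborel (sine_tilt m \<beta>) 1"
proof -
  let ?f = "normal_density 0 (sqrt 2)"
  have 1: "has_bochner_integral lborel ?f 1"
    by (simp add: has_bochner_integral_iff)
  have s: "has_bochner_integral lborel (\<lambda>x. \<beta> j * (?f x * sin (real j * x))) 0" for j
    using has_bochner_integral_mult_right[OF has_bochner_integral_normal_density_sin[of "sqrt 2" 0 0 "real j"]]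
    by simp
  have "has_bochner_integral lborel (\<lambda>x. ?f x + (\<Sum>j\<in>{1..m}. \<beta> j * (?f x * sin (real j * x)))) (1 + (\<Sum>j\<in>{1..m}. 0))"
    by (intro has_bochner_integral_add has_bochner_integral_sum 1 s)
  moreover have "?f x + (\<Sum>j\<in>{1..m}. \<beta> j * (?f x * sin (real j * x))) = sine_tilt m \<beta> x" for x
    by (simp add: sine_tilt_def sine_poly_def sum_distrib_left algebra_simps)
  ultimately show ?thesis by simp
qed

text \<open>The bound 1/2, rather than 1, keeps the tilt comparable with the normal density; the
  chi-square estimate needs this in its denominator.\<close>

lemma sine_tilt_ge:
  assumes "(\<Sum>j\<in>{1..m}. \<bar>\<beta> j\<bar>) \<le> 1/2"
  shows "sine_tilt m \<beta> x \<ge> normal_density 0 (sqrt 2) x / 2"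
proof -
  have "1 + sine_poly m \<beta> x \<ge> 1/2"
    using abs_sine_poly_le[of m \<beta> x] assms by linarith
  then have "normal_density 0 (sqrt 2) x * (1/2) \<le> sine_tilt m \<beta> x"
    unfolding sine_tilt_def by (rule mult_left_mono) simp
  then show ?thesis by simp
qed

lemma sine_tilt_pos:
  assumes "(\<Sum>j\<in>{1..m}. \<bar>\<beta> j\<bar>) \<le> 1/2"
  shows "sine_tilt m \<beta> x > 0"
  using sine_tilt_ge[OF assms, of x] normal_density_pos[of "sqrt 2" 0 x] by simp

lemma nn_integral_sine_tilt:
  assumes "(\<Sum>j\<in>{1..m}. \<bar>\<beta> j\<bar>) \<le> 1/2"
  shows "(\<integral>\<^sup>+x. ennreal (sine_tilt m \<beta> x) \<partial>lborel) = 1"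
  using has_bochner_integral_sine_tilt[of m \<beta>] sine_tilt_pos[OF assms]
  by (subst nn_integral_eq_integral) (auto simp: has_bochner_integral_iff less_imp_le)

text \<open>The mixing density is the standard normal one times \<open>w\<close>, whose coefficients
  undo the damping in advance. The hypothesis is what makes \<open>w\<close> nonnegative.\<close>

lemma sine_tilt_in_normal_mixtures:
  assumes b: "(\<Sum>j\<in>{1..m}. \<bar>\<beta> j\<bar> * exp ((real j)\<^sup>2)) \<le> 1"
  shows "sine_tilt m \<beta> \<in> normal_mixtures"
proof -
  define w where "w u = 1 + (\<Sum>j\<in>{1..m}. (\<beta> j * exp ((real j)\<^sup>2)) * sin (2 * real j * u))" for u
  define P where "P = density lborel (\<lambda>u. ennreal (std_normal_density u * w u))"
  have [measurable]: "w \<in> borel_measurable borel" unfolding w_def by measurable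
  have w: "w u \<ge> 0" for u
  proof -
    have "\<bar>\<Sum>j\<in>{1..m}. (\<beta> j * exp ((real j)\<^sup>2)) * sin (2 * real j * u)\<bar> \<le> (\<Sum>j\<in>{1..m}. \<bar>\<beta> j * exp ((real j)\<^sup>2)\<bar>)"
      by (rule abs_sum_mult_sin_le)
    also have "\<dots> \<le> 1" using b by (simp add: abs_mult)
    finally show ?thesis unfolding w_def by linarith
  qed
  \<comment> \<open>Needed for two normal laws: N(0, 1) gives the mixing measure mass one, and the
    conditional law N(x/2, 1/2) evaluates the convolution.\<close>
  have gen: "has_bochner_integral lborel (\<lambda>u. normal_density \<mu> \<sigma> u * w u)
      (1 + (\<Sum>j\<in>{1..m}. (\<beta> j * exp ((real j)\<^sup>2)) * (exp (- (2 * real j * \<sigma>)\<^sup>2 / 2) * sin (2 * real j * \<mu>))))"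
    if "\<sigma> > 0" for \<mu> \<sigma>
  proof -
    have 1: "has_bochner_integral lborel (normal_density \<mu> \<sigma>) 1"
      using that by (simp add: has_bochner_integral_iff)
    have s: "has_bochner_integral lborel (\<lambda>u. (\<beta> j * exp ((real j)\<^sup>2)) * (normal_density \<mu> \<sigma> u * sin (2 * real j * u)))
      ((\<beta> j * exp ((real j)\<^sup>2)) * (exp (- (2 * real j * \<sigma>)\<^sup>2 / 2) * sin (2 * real j * \<mu>)))" for j
      using has_bochner_integral_mult_right[OF has_bochner_integral_normal_density_sin[OF that, of \<mu> 0 "2 * real j"]]
      by simp
    have "has_bochner_integral lborel (\<lambda>u. normal_density \<mu> \<sigma> u +
         (\<Sum>j\<in>{1..m}. (\<beta> j * exp ((real j)\<^sup>2)) * (normal_density \<mu> \<sigma> u * sin (2 * real j * u))))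
      (1 + (\<Sum>j\<in>{1..m}. (\<beta> j * exp ((real j)\<^sup>2)) * (exp (- (2 * real j * \<sigma>)\<^sup>2 / 2) * sin (2 * real j * \<mu>))))"
      by (intro has_bochner_integral_add has_bochner_integral_sum 1 s)
    moreover have "normal_density \<mu> \<sigma> u +
         (\<Sum>j\<in>{1..m}. (\<beta> j * exp ((real j)\<^sup>2)) * (normal_density \<mu> \<sigma> u * sin (2 * real j * u)))
       = normal_density \<mu> \<sigma> u * w u" for u
      by (simp add: w_def sum_distrib_left algebra_simps)
    ultimately show ?thesis by simp
  qed
  have "has_bochner_integral lborel (\<lambda>u. std_normal_density u * w u) 1"
    using gen[of 1 0] by simp
  then have "(\<integral>\<^sup>+u. ennreal (std_normal_density u * w u) \<partial>lborel) = 1"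
    using w by (subst nn_integral_eq_integral) (auto simp: has_bochner_integral_iff)
  then have "prob_space P"
    by (intro prob_spaceI) (simp add: P_def emeasure_density)
  then have P: "P \<in> borel_prob_measures"
    by (simp add: borel_prob_measures_def P_def)
  have "normal_mixture P x = sine_tilt m \<beta> x" for x
  proof -
    have "normal_mixture P x = (\<integral>u. (std_normal_density u * w u) * std_normal_density (x - u) \<partial>lborel)"
      unfolding normal_mixture_def P_def using w by (subst integral_density) auto
    also have "\<dots> = (\<integral>u. normal_density 0 (sqrt 2) x * (normal_density (x / 2) (sqrt (1/2)) u * w u) \<partial>lborel)"
      using normal_density_mult_convolution_kernel[of _ x]
      by (intro Bochner_Integration.integral_cong) (auto simp: algebra_simps)
    also have "\<dots> = normal_density 0 (sqrt 2) x * (1 + (\<Sum>j\<in>{1..m}. (\<beta> j * exp ((real j)\<^sup>2)) *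
        (exp (- (2 * real j * sqrt (1/2))\<^sup>2 / 2) * sin (2 * real j * (x / 2)))))"
      using gen[of "sqrt (1/2)" "x / 2"] by (simp add: has_bochner_integral_iff del: real_sqrt_divide)
    \<comment> \<open>Frequency 2 j under variance 1/2 is damped by exp(-j^2), which cancels the
      prepared factor; the mean x/2 turns 2 j into j.\<close>
    also have "(\<Sum>j\<in>{1..m}. (\<beta> j * exp ((real j)\<^sup>2)) *
        (exp (- (2 * real j * sqrt (1/2))\<^sup>2 / 2) * sin (2 * real j * (x / 2)))) = sine_poly m \<beta> x"
      unfolding sine_poly_def
      by (intro sum.cong refl) (simp add: power_mult_distrib exp_minus)
    finally show ?thesis by (simp add: sine_tilt_def)
  qed
  then have "sine_tilt m \<beta> = normal_mixture P" by auto
  with P show ?thesis by (auto simp: normal_mixtures_def)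
qed

lemma chi_square_sine_tilt:
  assumes b: "(\<Sum>i\<in>{1..m}. \<bar>\<beta> i\<bar>) \<le> 1/2" and d: "\<bar>\<beta> j\<bar> \<le> d"
  shows "(\<integral>\<^sup>+x. ennreal ((sine_tilt m (\<beta>(j := 0)) x)\<^sup>2 / sine_tilt m \<beta> x) \<partial>lborel) \<le> ennreal (1 + 2 * d\<^sup>2)"
proof -
  let ?f = "normal_density 0 (sqrt 2)" and ?p = "sine_tilt m \<beta>" and ?r = "sine_tilt m (\<beta>(j := 0))"
  have d0: "d \<ge> 0" using d by linarith
  \<comment> \<open>Since r^2 / p = 2 r - p + (p - r)^2 / p, only the last term needs a bound: |p -
    r| is at most d f, and p is at least f / 2. The majorant is linear in three probability
    densities, hence easy to integrate.\<close>
  have pw: "(?r x)\<^sup>2 / ?p x \<le> 2 * ?r x - ?p x + 2 * d\<^sup>2 * ?f x" for x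
  proof -
    have f: "?f x > 0" by (simp add: normal_density_pos)
    have p: "?p x > 0" "?p x \<ge> ?f x / 2" using sine_tilt_pos[OF b] sine_tilt_ge[OF b] by auto
    have "sine_poly m \<beta> x - sine_poly m (\<beta>(j := 0)) x = (\<Sum>i\<in>{1..m}. if i = j then \<beta> j * sin (real j * x) else 0)"
      unfolding sine_poly_def sum_subtractf[symmetric] by (intro sum.cong) auto
    also have "\<bar>\<dots>\<bar> \<le> d"
      using d d0 mult_mono[of "\<bar>\<beta> j\<bar>" d "\<bar>sin (real j * x)\<bar>" 1] by (simp add: abs_mult)
    finally have "\<bar>sine_poly m \<beta> x - sine_poly m (\<beta>(j := 0)) x\<bar> * ?f x \<le> d * ?f x"
      using f by (intro mult_right_mono) auto
    then have e: "\<bar>?p x - ?r x\<bar> \<le> d * ?f x"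
      using f by (simp add: sine_tilt_def abs_mult mult.commute[of _ "?f x"] flip: right_diff_distrib)
    have "(?p x - ?r x)\<^sup>2 \<le> (d * ?f x)\<^sup>2"
      using e by (rule power2_le_iff_abs_le[THEN iffD2, rotated]) (use d0 f in auto)
    also have "\<dots> = 2 * d\<^sup>2 * ?f x * (?f x / 2)" by (simp add: power2_eq_square)
    also have "\<dots> \<le> 2 * d\<^sup>2 * ?f x * ?p x" using p f by (intro mult_left_mono) auto
    finally show ?thesis using p by (simp add: field_simps power2_eq_square)
  qed
  have i: "has_bochner_integral lborel (\<lambda>x. 2 * ?r x - ?p x + 2 * d\<^sup>2 * ?f x) (2 * 1 - 1 + 2 * d\<^sup>2 * 1)"
    by (intro has_bochner_integral_add has_bochner_integral_diff has_bochner_integral_mult_right has_bochner_integral_sine_tilt)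
       (simp add: has_bochner_integral_iff)
  have "(\<integral>\<^sup>+x. ennreal ((?r x)\<^sup>2 / ?p x) \<partial>lborel) \<le> (\<integral>\<^sup>+x. ennreal (2 * ?r x - ?p x + 2 * d\<^sup>2 * ?f x) \<partial>lborel)"
    by (intro nn_integral_mono ennreal_leI pw)
  also have "\<dots> = ennreal (1 + 2 * d\<^sup>2)"
    using i order_trans[OF _ pw] sine_tilt_pos[OF b]
    by (subst nn_integral_eq_integral) (auto simp: has_bochner_integral_iff less_imp_le)
  finally show ?thesis .
qed

section \<open>Reduction of the loss to sine coefficients\<close>

text \<open>Restricting the loss to one period and dividing by the normal density turns it into a
  distance to a sine polynomial with orthogonal terms.\<close>

lemma squared_error_sine_tilt_ge:
  fixes h :: "real \<Rightarrow> real"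
  assumes [measurable]: "h \<in> borel_measurable borel"
  defines "M \<equiv> restrict_space lborel {-pi..pi}"
  defines "g \<equiv> \<lambda>x. h x / normal_density 0 (sqrt 2) x - 1"
  shows "ennreal ((normal_density 0 (sqrt 2) pi)\<^sup>2 * pi *
      (\<Sum>j\<in>{1..m}. ((\<integral>x. g x * sin (real j * x) \<partial>M) / pi - \<beta> j)\<^sup>2))
    \<le> (\<integral>\<^sup>+x. ennreal ((h x - sine_tilt m \<beta> x)\<^sup>2) \<partial>lborel)"
proof -
  let ?f = "normal_density 0 (sqrt 2)"
  let ?F = "ennreal ((?f pi)\<^sup>2)"
  have [measurable]: "g \<in> borel_measurable borel" unfolding g_def by measurable
  have gM: "g \<in> borel_measurable M" unfolding M_def by (simp add: measurable_restrict_space1)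
  have sM: "(\<lambda>x. sin (real j * x)) \<in> borel_measurable M" for j
    unfolding M_def by (rule measurable_restrict_space1) simp
  have "ennreal ((?f pi)\<^sup>2 * pi * (\<Sum>j\<in>{1..m}. ((\<integral>x. g x * sin (real j * x) \<partial>M) / pi - \<beta> j)\<^sup>2))
      = ?F * ennreal (pi * (\<Sum>j\<in>{1..m}. ((\<integral>x. g x * sin (real j * x) \<partial>M) / pi - \<beta> j)\<^sup>2))"
    by (simp add: ennreal_mult[symmetric] sum_nonneg mult.assoc)
  also have "\<dots> \<le> ?F * (\<integral>\<^sup>+x. ennreal ((g x - (\<Sum>j\<in>{1..m}. \<beta> j * sin (real j * x)))\<^sup>2) \<partial>M)"
    by (intro mult_left_mono bessel_lower_bound gM sM)
       (auto simp: M_def integrable_sin_mult_sin integral_sin_mult_sin)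
  also have "\<dots> = (\<integral>\<^sup>+x. ?F * ennreal ((g x - sine_poly m \<beta> x)\<^sup>2) * indicator {-pi..pi} x \<partial>lborel)"
    unfolding sine_poly_def[symmetric] M_def
    by (subst nn_integral_restrict_space) (auto simp: nn_integral_cmult[symmetric] mult.assoc)
  also have "\<dots> \<le> (\<integral>\<^sup>+x. ennreal ((h x - sine_tilt m \<beta> x)\<^sup>2) \<partial>lborel)"
  proof (rule nn_integral_mono)
    fix x :: real
    have f: "?f x > 0" by (simp add: normal_density_pos)
    \<comment> \<open>On the period the normal density is smallest at the endpoints.\<close>
    have "?f pi \<le> ?f x" if "x \<in> {-pi..pi}"
    proof -
      have "x\<^sup>2 \<le> pi\<^sup>2" using that by (intro power2_le_iff_abs_le[THEN iffD2]) auto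
      then show ?thesis by (simp add: normal_density_def divide_right_mono)
    qed
    then have "(?f pi)\<^sup>2 * (g x - sine_poly m \<beta> x)\<^sup>2 \<le> (?f x)\<^sup>2 * (g x - sine_poly m \<beta> x)\<^sup>2" if "x \<in> {-pi..pi}"
      using that by (intro mult_right_mono power_mono) auto
    \<comment> \<open>\<open>g\<close> is defined so that h = f (1 + g), matching the form of the
      tilt.\<close>
    also have "(?f x)\<^sup>2 * (g x - sine_poly m \<beta> x)\<^sup>2 = (h x - sine_tilt m \<beta> x)\<^sup>2"
      unfolding power_mult_distrib[symmetric] using f
      by (simp add: g_def sine_tilt_def right_diff_distrib distrib_left diff_diff_eq)
    finally show "?F * ennreal ((g x - sine_poly m \<beta> x)\<^sup>2) * indicator {-pi..pi} x \<le> ennreal ((h x - sine_tilt m \<beta> x)\<^sup>2)"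
      by (auto simp: indicator_def ennreal_mult[symmetric] intro!: ennreal_leI)
  qed
  finally show ?thesis .
qed

section \<open>Frequency budget, product laws and the final bound\<close>

text \<open>With L = ln n the right-hand side is a constant times sqrt n. The cutoff sqrt L / 2
  makes exp(m^2) only about exp(L/4); the spare exp(L/4) absorbs the number of terms and the
  rounding of \<open>m\<close>.\<close>

lemma sum_exp_square_le:
  assumes "L \<ge> 0" "real m \<le> sqrt L / 2 + 1"
  shows "(\<Sum>j\<in>{1..m}. exp ((real j)\<^sup>2)) \<le> exp (L / 2 + 17 / 4)"
proof -
  have "(\<Sum>j\<in>{1..m}. exp ((real j)\<^sup>2)) \<le> (\<Sum>j\<in>{1..m}. exp ((real m)\<^sup>2))"
    by (intro sum_mono) auto
  also have "\<dots> \<le> exp (real m) * exp ((real m)\<^sup>2)"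
    using exp_ge_add_one_self[of "real m"] by (simp del: exp_ge_add_one_self)
  also have "\<dots> = exp (real m + (real m)\<^sup>2)" by (simp add: exp_add)
  also have "\<dots> \<le> exp (L / 2 + 17 / 4)"
  proof -
    have "real m + (real m)\<^sup>2 \<le> (sqrt L / 2 + 1) + (sqrt L / 2 + 1)\<^sup>2"
      using assms by (intro add_mono power_mono) auto
    also have "\<dots> = L / 4 + 3 / 2 * sqrt L + 2"
      using assms(1) by (simp add: power2_eq_square field_simps)
    \<comment> \<open>The square of sqrt L / 2 - 3/2 is nonnegative, which costs 9/4; together with
      the 2 above this gives 17/4.\<close>
    also have "\<dots> \<le> L / 2 + 17 / 4"
      using zero_le_power2[of "sqrt L / 2 - 3 / 2"] assms(1) by (simp add: power2_eq_square field_simps)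
    finally show ?thesis by simp
  qed
  finally show ?thesis .
qed

lemma L2_risk_sine_tilt:
  assumes est: "estimator n fhat" and b: "(\<Sum>j\<in>{1..m}. \<bar>\<beta> j\<bar>) \<le> 1/2"
  shows "(\<lambda>X. \<integral>\<^sup>+x. ennreal ((fhat x X - sine_tilt m \<beta> x)\<^sup>2) \<partial>lborel)
           \<in> borel_measurable (\<Pi>\<^sub>M i\<in>{1..n}. lborel)" (is "?L \<in> _")
    and "L2_risk n fhat (sine_tilt m \<beta>) =
      (\<integral>\<^sup>+X. ennreal (\<Prod>i\<in>{1..n}. sine_tilt m \<beta> (X i)) * (\<integral>\<^sup>+x. ennreal ((fhat x X - sine_tilt m \<beta> x)\<^sup>2) \<partial>lborel)
        \<partial>(\<Pi>\<^sub>M i\<in>{1..n}. lborel))"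
proof -
  \<comment> \<open>\<open>estimator\<close> is stated over \<open>borel\<close>, the integrals are
    over \<open>lborel\<close>. The sigma-algebras coincide, and sigma-finiteness of
    \<open>lborel\<close> makes the loss measurable in the sample.\<close>
  have sets: "sets (lborel \<Otimes>\<^sub>M (\<Pi>\<^sub>M i\<in>{1..n}. lborel)) = sets (borel \<Otimes>\<^sub>M (\<Pi>\<^sub>M i\<in>{1..n}. borel :: real measure))"
    by (intro sets_pair_measure_cong sets_PiM_cong) auto
  have [measurable]: "(\<lambda>(x, X). fhat x X) \<in> borel_measurable (lborel \<Otimes>\<^sub>M (\<Pi>\<^sub>M i\<in>{1..n}. lborel))"
    using est unfolding estimator_def by (simp add: measurable_cong_sets[OF sets refl])
  show L[measurable]: "?L \<in> borel_measurable (\<Pi>\<^sub>M i\<in>{1..n}. lborel)"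
    by measurable
  have "prob_space (density lborel (\<lambda>x. ennreal (sine_tilt m \<beta> x)))"
    by (intro prob_spaceI) (simp add: emeasure_density nn_integral_sine_tilt[OF b])
  then interpret prob_space "density lborel (\<lambda>x. ennreal (sine_tilt m \<beta> x))" .
  have "iid_law n (sine_tilt m \<beta>) = density (\<Pi>\<^sub>M i\<in>{1..n}. lborel) (\<lambda>X. ennreal (\<Prod>i\<in>{1..n}. sine_tilt m \<beta> (X i)))"
    unfolding iid_law_def using sine_tilt_pos[OF b]
    by (intro PiM_density_lborel) (auto simp: less_imp_le intro: sigma_finite_measure_axioms)
  then show "L2_risk n fhat (sine_tilt m \<beta>) =
      (\<integral>\<^sup>+X. ennreal (\<Prod>i\<in>{1..n}. sine_tilt m \<beta> (X i)) * ?L X \<partial>(\<Pi>\<^sub>M i\<in>{1..n}. lborel))"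
    unfolding L2_risk_def by (simp only:) (rule nn_integral_density; measurable)
qed

text \<open>The chi-square integral tensorises, so it is at most (1 + 2 d^2)^n, hence at most exp(2
  n d^2), at most e, below 3.\<close>

lemma chi_square_prod_sine_tilt:
  assumes b: "(\<Sum>i\<in>{1..m}. \<bar>\<beta> i\<bar>) \<le> 1/2" and d: "\<bar>\<beta> j\<bar> \<le> d" and n: "2 * real n * d\<^sup>2 \<le> 1"
  shows "(\<integral>\<^sup>+X. ennreal ((\<Prod>i\<in>{1..n}. sine_tilt m (\<beta>(j := 0)) (X i))\<^sup>2 / (\<Prod>i\<in>{1..n}. sine_tilt m \<beta> (X i)))
     \<partial>(\<Pi>\<^sub>M i\<in>{1..n}. lborel)) \<le> ennreal 3"
proof -
  have "(1 + 2 * d\<^sup>2) ^ n \<le> exp (2 * d\<^sup>2) ^ n"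
    using exp_ge_add_one_self by (intro power_mono) auto
  also have "exp (2 * d\<^sup>2) ^ n = exp (2 * real n * d\<^sup>2)"
    by (simp add: exp_of_nat_mult[symmetric] mult_ac)
  also have "\<dots> \<le> exp 1" using n by simp
  also have "\<dots> \<le> (3 :: real)" by (rule exp_le)
  finally have le: "(1 + 2 * d\<^sup>2) ^ n \<le> 3" .
  have "(\<integral>\<^sup>+X. ennreal ((\<Prod>i\<in>{1..n}. sine_tilt m (\<beta>(j := 0)) (X i))\<^sup>2 / (\<Prod>i\<in>{1..n}. sine_tilt m \<beta> (X i)))
     \<partial>(\<Pi>\<^sub>M i\<in>{1..n}. lborel))
    = (\<integral>\<^sup>+X. ennreal (\<Prod>i\<in>{1..n}. (sine_tilt m (\<beta>(j := 0)) (X i))\<^sup>2 / sine_tilt m \<beta> (X i)) \<partial>(\<Pi>\<^sub>M i\<in>{1..n}. lborel))"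
    by (simp add: prod_dividef prod_power_distrib)
  also have "\<dots> = (\<integral>\<^sup>+x. ennreal ((sine_tilt m (\<beta>(j := 0)) x)\<^sup>2 / sine_tilt m \<beta> x) \<partial>lborel) ^ n"
    using sine_tilt_pos[OF b] nn_integral_PiM_lborel_prod[of "{1..n}" "\<lambda>x. (sine_tilt m (\<beta>(j := 0)) x)\<^sup>2 / sine_tilt m \<beta> x"]
    by (simp add: less_imp_le)
  also have "\<dots> \<le> ennreal (1 + 2 * d\<^sup>2) ^ n"
    by (intro power_mono chi_square_sine_tilt b d) simp
  also have "\<dots> = ennreal ((1 + 2 * d\<^sup>2) ^ n)" by (intro ennreal_power) simp
  also have "\<dots> \<le> ennreal 3"
    using le by (rule ennreal_leI)
  finally show ?thesis .
qed

lemma sup_risk_ge: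
  assumes est: "estimator n fhat" and d: "d \<ge> 0" and n: "2 * real n * d\<^sup>2 \<le> 1"
    and de: "d * (\<Sum>j\<in>{1..m}. exp ((real j)\<^sup>2)) \<le> 1/2"
  shows "ennreal ((normal_density 0 (sqrt 2) pi)\<^sup>2 * pi / 3 * real m * d\<^sup>2)
    \<le> (SUP f\<in>normal_mixtures. L2_risk n fhat f)" (is "_ \<le> ?R")
proof -
  let ?M = "\<Pi>\<^sub>M i\<in>{1..n}. lborel :: real measure"
  let ?I = "{1..m}"
  define B where "B = (normal_density 0 (sqrt 2) pi)\<^sup>2 * pi"
  define \<theta> where "\<theta> S j = d * sgn_mem S j" for S :: "nat set" and j
  have B: "B > 0" by (simp add: B_def less_imp_neq[OF normal_density_pos, symmetric])
  have th: "\<bar>\<theta> S j\<bar> = d" for S j using d by (simp add: \<theta>_def sgn_mem_def)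
  \<comment> \<open>Each exp(j^2) is at least 1, so the mixing condition \<open>de\<close> also
    controls the plain sum of coefficients.\<close>
  have "d * (\<Sum>j\<in>?I. 1) \<le> d * (\<Sum>j\<in>?I. exp ((real j)\<^sup>2))"
    using d by (intro mult_left_mono sum_mono) auto
  then have dm: "real m * d \<le> 1/2" using de by (simp add: mult.commute)
  have s1: "(\<Sum>j\<in>?I. \<bar>\<theta> S j\<bar>) \<le> 1/2" for S using dm by (simp add: th)
  have s0: "(\<Sum>i\<in>?I. \<bar>((\<theta> S)(j := 0)) i\<bar>) \<le> 1/2" for S j
    by (rule order_trans[OF sum_mono s1[of S]]) simp
  have mix: "sine_tilt m (\<theta> S) \<in> normal_mixtures" for S
    using de by (intro sine_tilt_in_normal_mixtures) (simp add: th sum_distrib_left[symmetric])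
  define p where "p S X = (\<Prod>i\<in>{1..n}. sine_tilt m (\<theta> S) (X i))" for S X
  define r where "r j S X = (\<Prod>i\<in>{1..n}. sine_tilt m ((\<theta> S)(j := 0)) (X i))" for j S X
  define L where "L S X = (\<integral>\<^sup>+x. ennreal ((fhat x X - sine_tilt m (\<theta> S) x)\<^sup>2) \<partial>lborel)" for S X
  \<comment> \<open>The sine coefficient of the normalised estimate: it depends on the sample but
    not on the sign pattern.\<close>
  define t where "t j X = (\<integral>x. (fhat x X / normal_density 0 (sqrt 2) x - 1) * sin (real j * x)
     \<partial>restrict_space lborel {-pi..pi}) / pi" for j X
  have risk: "L2_risk n fhat (sine_tilt m (\<theta> S)) = (\<integral>\<^sup>+X. ennreal (p S X) * L S X \<partial>?M)"
    and Lm: "L S \<in> borel_measurable ?M" for S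
    using L2_risk_sine_tilt[OF est s1] by (simp_all add: p_def L_def[abs_def])
  have pm: "p S \<in> borel_measurable ?M" and rm: "r j S \<in> borel_measurable ?M" for j S
    by (simp_all add: p_def[abs_def] r_def[abs_def])
  \<comment> \<open>The loss is rescaled by 1 / B so that it dominates the sum of squared
    coefficient errors with constant one.\<close>
  have cL: "(\<lambda>X. ennreal (1 / B) * L S X) \<in> borel_measurable ?M" for S
    using Lm[of S] by measurable
  have p_pos: "p S X > 0" for S X
    unfolding p_def by (intro prod_pos ballI sine_tilt_pos s1)
  have r_nonneg: "r j S X \<ge> 0" for j S X
    unfolding r_def by (intro prod_nonneg ballI less_imp_le sine_tilt_pos s0)
  have L_ge: "ennreal B * ennreal (\<Sum>j\<in>?I. (t j X - d * sgn_mem S j)\<^sup>2) \<le> L S X" if X: "X \<in> space ?M" for S X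
  proof -
    have "(\<lambda>(x, X). fhat x X) \<in> borel_measurable (borel \<Otimes>\<^sub>M (\<Pi>\<^sub>M i\<in>{1..n}. borel))"
      using est by (simp add: estimator_def)
    moreover have "X \<in> space (\<Pi>\<^sub>M i\<in>{1..n}. borel :: real measure)"
      using X by (simp add: space_PiM)
    ultimately have "(\<lambda>x. fhat x X) \<in> borel_measurable borel"
      using measurable_Pair1'[of X "\<Pi>\<^sub>M i\<in>{1..n}. borel" borel] measurable_compose by force
    from squared_error_sine_tilt_ge[OF this, where m = m and \<beta> = "\<theta> S"] show ?thesis
      using B by (simp add: L_def t_def \<theta>_def B_def[symmetric] ennreal_mult[symmetric] sum_nonneg)
  qed
  have "ennreal (real (card ?I) * 2 ^ card ?I * d\<^sup>2 / 3)
      \<le> (\<Sum>S\<in>Pow ?I. \<integral>\<^sup>+X. ennreal (p S X) * (ennreal (1 / B) * L S X) \<partial>?M)"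
  proof (rule assouad_chi_square[where r = r and t = t])
    fix j :: nat and S :: "nat set"
    \<comment> \<open>Overwriting the j-th coefficient by 0 forgets its sign, so both ends of an
      edge have the same reference.\<close>
    have "(\<theta> (insert j S))(j := 0) = (\<theta> S)(j := 0)" by (auto simp: \<theta>_def sgn_mem_def)
    then show "r j (insert j S) = r j S" by (simp add: r_def[abs_def])
    show "(\<integral>\<^sup>+X. ennreal (r j S X) \<partial>?M) = 1"
      using nn_integral_PiM_lborel_prod[of "{1..n}" "sine_tilt m ((\<theta> S)(j := 0))"] sine_tilt_pos[OF s0]
      by (simp add: r_def nn_integral_sine_tilt[OF s0] less_imp_le)
    show "(\<integral>\<^sup>+X. ennreal ((r j S X)\<^sup>2 / p S X) \<partial>?M) \<le> ennreal 3"
      unfolding r_def p_def by (rule chi_square_prod_sine_tilt[OF s1 _ n]) (simp add: th)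
  next
    fix S X assume X: "X \<in> space ?M"
    have "ennreal (\<Sum>j\<in>?I. (t j X - d * sgn_mem S j)\<^sup>2)
       = ennreal (1 / B) * (ennreal B * ennreal (\<Sum>j\<in>?I. (t j X - d * sgn_mem S j)\<^sup>2))"
      using B by (simp add: mult.assoc[symmetric] ennreal_mult[symmetric])
    also have "\<dots> \<le> ennreal (1 / B) * L S X" by (intro mult_left_mono L_ge X) simp
    finally show "ennreal (\<Sum>j\<in>?I. (t j X - d * sgn_mem S j)\<^sup>2) \<le> ennreal (1 / B) * L S X" .
  qed (use pm rm cL in \<open>simp_all add: d p_pos r_nonneg\<close>)
  also have "\<dots> = ennreal (1 / B) * (\<Sum>S\<in>Pow ?I. L2_risk n fhat (sine_tilt m (\<theta> S)))"
    unfolding risk sum_distrib_left using pm Lm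
    by (intro sum.cong refl, subst nn_integral_cmult[symmetric]) (auto simp: mult_ac)
  \<comment> \<open>The supremum dominates the risk at each of the 2^m patterns, all of which are
    admissible mixtures.\<close>
  also have "\<dots> \<le> ennreal (1 / B) * (\<Sum>S\<in>Pow ?I. ?R)"
    by (intro mult_left_mono sum_mono SUP_upper mix) auto
  also have "\<dots> = ennreal (2 ^ m / B) * ?R"
  proof -
    have "(\<Sum>S\<in>Pow ?I. ?R) = ennreal (2 ^ m) * ?R"
      by (simp add: card_Pow ennreal_power[symmetric])
    moreover have "ennreal (1 / B) * ennreal (2 ^ m) = ennreal (2 ^ m / B)"
      using B by (subst ennreal_mult[symmetric]) auto
    ultimately show ?thesis by (simp only: mult.assoc[symmetric])
  qed
  finally have "ennreal (B / 2 ^ m) * ennreal (real (card ?I) * 2 ^ card ?I * d\<^sup>2 / 3)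
      \<le> ennreal (B / 2 ^ m) * (ennreal (2 ^ m / B) * ?R)"
    by (intro mult_left_mono) auto
  moreover have "ennreal (B / 2 ^ m) * ennreal (real (card ?I) * 2 ^ card ?I * d\<^sup>2 / 3)
      = ennreal (B / 3 * real m * d\<^sup>2)"
    using B by (subst ennreal_mult[symmetric]) auto
  moreover have "ennreal (B / 2 ^ m) * (ennreal (2 ^ m / B) * ?R) = ?R"
  proof -
    have "ennreal (B / 2 ^ m) * ennreal (2 ^ m / B) = 1"
      using B by (subst ennreal_mult[symmetric]) auto
    then show ?thesis by (simp only: mult.assoc[symmetric] mult_1)
  qed
  ultimately show ?thesis by (simp only: B_def)
qed

theorem theorem1p1:
  shows "\<exists>c::real. c > 0 \<and>
    (\<forall>n::nat. n \<ge> 2 \<longrightarrow> (\<forall>fhat. estimator n fhat \<longrightarrow>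
      (SUP f\<in>normal_mixtures. L2_risk n fhat f)
        \<ge> ennreal (c * ln (real n) * (1 / (real n * sqrt (ln (real n)))))))"
proof -
  \<comment> \<open>Chosen to cancel the constant exp(17/4) of \<open>sum_exp_square_le\<close> and
    leave exactly 1/2 for the mixing condition.\<close>
  define \<kappa> where "\<kappa> = exp (- 17 / 4) / (2 :: real)"
  define a where "a = (normal_density 0 (sqrt 2) pi)\<^sup>2 * pi / 3"
  have a: "a > 0" by (simp add: a_def less_imp_neq[OF normal_density_pos, symmetric])
  have k: "\<kappa> > 0" "\<kappa> \<le> 1/2" by (simp_all add: \<kappa>_def)
  show ?thesis
  proof (intro exI[of _ "a * \<kappa>\<^sup>2 / 2"] conjI allI impI)
    show "a * \<kappa>\<^sup>2 / 2 > 0" using a k by simp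
    fix n :: nat and fhat assume n: "n \<ge> 2" and est: "estimator n fhat"
    define l where "l = ln (real n)"
    have l: "l > 0" using n by (simp add: l_def)
    have exp_l: "exp (l / 2) = sqrt (real n)"
      using n by (simp add: l_def ln_sqrt[symmetric])
    \<comment> \<open>Adding 1 after rounding down keeps at least one frequency for small
      \<open>n\<close> and places \<open>m\<close> between sqrt l / 2 and sqrt l / 2 + 1.\<close>
    define m where "m = nat \<lfloor>sqrt l / 2\<rfloor> + 1"
    have "real_of_int \<lfloor>sqrt l / 2\<rfloor> \<le> sqrt l / 2" "sqrt l / 2 < real_of_int \<lfloor>sqrt l / 2\<rfloor> + 1" "\<lfloor>sqrt l / 2\<rfloor> \<ge> 0"
      using l by (linarith, linarith, simp)
    then have m: "real m \<le> sqrt l / 2 + 1" "sqrt l / 2 \<le> real m"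
      unfolding m_def by (simp, linarith)
    define d where "d = \<kappa> / sqrt (real n)"
    have d2: "d\<^sup>2 = \<kappa>\<^sup>2 / real n" using n by (simp add: d_def power_divide)
    have "\<kappa>\<^sup>2 \<le> (1/2)\<^sup>2" using k by (intro power_mono) auto
    then have nd: "2 * real n * d\<^sup>2 \<le> 1" unfolding d2 using n by (simp add: power2_eq_square)
    have "d * (\<Sum>j\<in>{1..m}. exp ((real j)\<^sup>2)) \<le> d * exp (l / 2 + 17 / 4)"
      using sum_exp_square_le[OF _ m(1)] l k by (intro mult_left_mono) (auto simp: d_def)
    also have "\<dots> = 1/2"
      using n by (simp add: d_def \<kappa>_def exp_add exp_l exp_minus)
    finally have "ennreal (a * real m * d\<^sup>2) \<le> (SUP f\<in>normal_mixtures. L2_risk n fhat f)"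
      unfolding a_def using k by (intro sup_risk_ge[OF est _ nd]) (auto simp: d_def)
    moreover have "a * \<kappa>\<^sup>2 / 2 * ln (real n) * (1 / (real n * sqrt (ln (real n)))) \<le> a * real m * d\<^sup>2"
    proof -
      \<comment> \<open>As l / sqrt l = sqrt l, the stated rate is sqrt l / n; the factor 1/2 in the
        constant comes from \<open>m\<close> being at least sqrt l / 2.\<close>
      have "a * \<kappa>\<^sup>2 / 2 * l * (1 / (real n * sqrt l)) = a * ((l / sqrt l) / 2) * (\<kappa>\<^sup>2 / real n)"
        by (simp add: mult_ac)
      also have "\<dots> = a * (sqrt l / 2) * (\<kappa>\<^sup>2 / real n)"
        using l by (simp only: real_div_sqrt)
      also have "\<dots> \<le> a * real m * d\<^sup>2"
        unfolding d2 using m(2) a by (intro mult_right_mono mult_left_mono) auto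
      finally show ?thesis by (simp add: l_def)
    qed
    ultimately show "ennreal (a * \<kappa>\<^sup>2 / 2 * ln (real n) * (1 / (real n * sqrt (ln (real n)))))
        \<le> (SUP f\<in>normal_mixtures. L2_risk n fhat f)"
      using ennreal_leI order_trans by blast
  qed
qed

end
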